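(* The product $V(\omega_1)\times V(\omega_1)$ is not a $2$-Ascoli space.
   Context: For a cardinal $\kappa$, the Fréchet–Urysohn fan $V(\kappa)$ is the quotient space obtained from $\kappa$ many pairwise disjoint one-to-one convergent sequences (with limits) by identifying all their limit points. Explicitly, $V(\kappa)=\bigcup_{i\in\kappa}S_i$, where each $S_i$ is a nontrivial convergent sequence with limit $x_\infty$, $S_i\cap S_j=\{x_\infty\}$ for $i\neq j$, all points other than $x_\infty$ are isolated, and a neighborhood of $x_\infty$ is any set $U\ni x_\infty$ such that $S_i\setminus U$ is finite for every $i\in\kappa$. Let $\mathbf{2}=\{0,1\}$ be the discrete two-point space. For a Tychonoff space $X$, $C_k(X,\mathbf{2})$ is the space of continuous functions $X\to\mathbf{2}$ with the compact-open topology. $X$ is $2$-Ascoli if every compact subset $K$ of $C_k(X,\mathbf{2})$ is evenly continuous, i.e. the evaluation map $K\times X\to\mathbf{2}$, $(f,x)\mapsto f(x)$, is continuous. *)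

theory Defs
  imports "HOL-Analysis.Analysis"
begin

unbundle cardinal_syntax

datatype 'i fan_point = Apex | Node 'i nat

definition fan_set :: "'i set \<Rightarrow> 'i fan_point set" where
  "fan_set I = insert Apex {Node i n |i n. i \<in> I}"

text \<open>
  The Frechet-Urysohn fan \<open>V(\<kappa>)\<close>, for \<open>\<kappa>\<close> the cardinality of the index set \<open>I\<close>.
  The sequence \<open>S\<^sub>i\<close> is \<open>{Apex} \<union> {Node i n | n. True}\<close>; its limit is \<open>Apex\<close>.
\<close>

definition fan :: "'i set \<Rightarrow> 'i fan_point topology" where
  "fan I = topology (\<lambda>U. U \<subseteq> fan_set I \<and>
      (Apex \<in> U \<longrightarrow> (\<forall>i\<in>I. finite {n. Node i n \<notin> U})))"

lemma openin_fan:
  "openin (fan I) U \<longleftrightarrow>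
     U \<subseteq> fan_set I \<and> (Apex \<in> U \<longrightarrow> (\<forall>i\<in>I. finite {n. Node i n \<notin> U}))"
proof -
  have "istopology (\<lambda>U. U \<subseteq> fan_set I \<and> (Apex \<in> U \<longrightarrow> (\<forall>i\<in>I. finite {n. Node i n \<notin> U})))"
    unfolding istopology_def
  proof (intro conjI allI impI)
    fix S T
    assume S: "S \<subseteq> fan_set I \<and> (Apex \<in> S \<longrightarrow> (\<forall>i\<in>I. finite {n. Node i n \<notin> S}))"
      and T: "T \<subseteq> fan_set I \<and> (Apex \<in> T \<longrightarrow> (\<forall>i\<in>I. finite {n. Node i n \<notin> T}))"
    show "S \<inter> T \<subseteq> fan_set I" using S by blast
    have "{n. Node i n \<notin> S \<inter> T} = {n. Node i n \<notin> S} \<union> {n. Node i n \<notin> T}" for i by blast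
    then show "\<forall>i\<in>I. finite {n. Node i n \<notin> S \<inter> T}" if "Apex \<in> S \<inter> T"
      using S T that by simp
  next
    fix \<K>
    assume K: "\<forall>S\<in>\<K>. S \<subseteq> fan_set I \<and> (Apex \<in> S \<longrightarrow> (\<forall>i\<in>I. finite {n. Node i n \<notin> S}))"
    then show "\<Union>\<K> \<subseteq> fan_set I" by blast
    show "\<forall>i\<in>I. finite {n. Node i n \<notin> \<Union>\<K>}" if ap: "Apex \<in> \<Union>\<K>"
    proof
      fix i assume "i \<in> I"
      obtain S where "S \<in> \<K>" "Apex \<in> S" using ap by blast
      then have "finite {n. Node i n \<notin> S}" using K \<open>i \<in> I\<close> by blast
      then show "finite {n. Node i n \<notin> \<Union>\<K>}"
        by (rule rev_finite_subset) (use \<open>S \<in> \<K>\<close> in blast)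
    qed
  qed
  then show ?thesis unfolding fan_def by simp
qed

lemma topspace_fan [simp]: "topspace (fan I) = fan_set I"
proof
  show "topspace (fan I) \<subseteq> fan_set I" using openin_fan openin_topspace by blast
  have "openin (fan I) (fan_set I)" by (auto simp: openin_fan fan_set_def)
  then show "fan_set I \<subseteq> topspace (fan I)" by (rule openin_subset)
qed

lemma openin_fan_no_Apex: "U \<subseteq> fan_set I \<Longrightarrow> Apex \<notin> U \<Longrightarrow> openin (fan I) U"
  by (simp add: openin_fan)

lemma openin_fan_minus_Node: "openin (fan I) (fan_set I - {Node i n})"
proof -
  have "{m. Node j m \<notin> fan_set I - {Node i n}} \<subseteq> {n}" if "j \<in> I" for j
    using that by (auto simp: fan_set_def)
  then show ?thesis
    by (auto simp: openin_fan intro: finite_subset)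
qed

lemma Hausdorff_space_fan: "Hausdorff_space (fan I)"
  unfolding Hausdorff_space_def
proof (intro allI impI)
  fix x y assume A: "x \<in> topspace (fan I) \<and> y \<in> topspace (fan I) \<and> x \<noteq> y"
  have *: "\<exists>U V. openin (fan I) U \<and> openin (fan I) V \<and> a \<in> U \<and> b \<in> V \<and> disjnt U V"
    if "a \<in> fan_set I" "b \<in> fan_set I" "a \<noteq> b" "a \<noteq> Apex" for a b
  proof (intro exI conjI)
    show "openin (fan I) {a}" using that by (intro openin_fan_no_Apex) auto
    show "openin (fan I) (fan_set I - {a})"
      using that openin_fan_minus_Node by (cases a) auto
  qed (use that in \<open>auto simp: disjnt_def\<close>)
  show "\<exists>U V. openin (fan I) U \<and> openin (fan I) V \<and> x \<in> U \<and> y \<in> V \<and> disjnt U V"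
  proof (cases "x = Apex")
    case True
    then have "\<exists>U V. openin (fan I) U \<and> openin (fan I) V \<and> y \<in> U \<and> x \<in> V \<and> disjnt U V"
      using A by (intro *) auto
    then show ?thesis by (meson disjnt_sym)
  next
    case False then show ?thesis using A by (intro *) auto
  qed
qed

lemma completely_regular_space_fan: "completely_regular_space (fan I)"
  unfolding completely_regular_space_def
proof (intro allI impI)
  fix C x assume A: "closedin (fan I) C \<and> x \<in> topspace (fan I) - C"
  define W where "W = (if x = Apex then fan_set I - C else {x})"
  have oW: "openin (fan I) W"
    using A by (auto simp: W_def closedin_def intro!: openin_fan_no_Apex)
  have cW: "openin (fan I) (fan_set I - W)"
  proof (cases "x = Apex")
    case True
    then have "Apex \<notin> fan_set I - W" using A by (auto simp: W_def)
    then show ?thesis by (intro openin_fan_no_Apex) auto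
  next
    case False
    then obtain i n where "x = Node i n" by (cases x) auto
    then show ?thesis using openin_fan_minus_Node[of I i n] by (simp add: W_def)
  qed
  define f :: "'a fan_point \<Rightarrow> real" where "f z = (if z \<in> W then 0 else 1)" for z
  have "continuous_map (fan I) (top_of_set {0..1}) f"
    unfolding continuous_map
  proof (intro conjI allI impI)
    show "f ` topspace (fan I) \<subseteq> topspace (top_of_set {0..1})" by (auto simp: f_def)
    fix U assume "openin (top_of_set {0..1::real}) U"
    have "{z \<in> topspace (fan I). f z \<in> U} =
       (if 0 \<in> U then W else {}) \<union> (if 1 \<in> U then fan_set I - W else {})"
      using openin_subset[OF oW] by (auto simp: f_def)
    then show "openin (fan I) {z \<in> topspace (fan I). f z \<in> U}"
      using openin_Un[OF oW cW] oW cW by (simp split: if_splits)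
  qed
  moreover have "f x = 0" by (use A in \<open>auto simp: f_def W_def\<close>)
  moreover have "f ` C \<subseteq> {1}"
    using A by (auto simp: f_def W_def)
  ultimately show "\<exists>f. continuous_map (fan I) (top_of_set {0..1::real}) f \<and> f x = 0 \<and> f ` C \<subseteq> {1}"
    by blast
qed

abbreviation two :: "nat topology" where
  "two \<equiv> discrete_topology {0, 1}"

text \<open>
  Continuous maps are represented by their extensional representatives (value
  \<^term>\<open>undefined\<close> outside the domain), so that each map on \<^term>\<open>topspace X\<close> is counted once.
\<close>

definition cont_maps :: "'a topology \<Rightarrow> 'b topology \<Rightarrow> ('a \<Rightarrow> 'b) set" where
  "cont_maps X Y = {f \<in> extensional (topspace X). continuous_map X Y f}"

definition compact_open_topology :: "'a topology \<Rightarrow> 'b topology \<Rightarrow> ('a \<Rightarrow> 'b) topology" where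
  "compact_open_topology X Y =
     topology_generated_by {{f \<in> cont_maps X Y. f ` K \<subseteq> U} |K U. compactin X K \<and> openin Y U}"

lemma topspace_compact_open_topology [simp]:
  "topspace (compact_open_topology X Y) = cont_maps X Y"
proof -
  have "cont_maps X Y \<in> {{f \<in> cont_maps X Y. f ` K \<subseteq> U} |K U. compactin X K \<and> openin Y U}"
    by (rule CollectI, rule exI[of _ "{}"], rule exI[of _ "{}"]) auto
  then show ?thesis
    unfolding compact_open_topology_def topology_generated_by_topspace by blast
qed

definition evenly_continuous :: "'a topology \<Rightarrow> 'b topology \<Rightarrow> ('a \<Rightarrow> 'b) set \<Rightarrow> bool" where
  "evenly_continuous X Y K \<longleftrightarrow>
     continuous_map (prod_topology (subtopology (compact_open_topology X Y) K) X) Y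
       (\<lambda>(f, x). f x)"

text \<open>
  The notion is used for Tychonoff spaces only. This is not part of the definition, so that the
  negation of \<open>two_Ascoli\<close> always refers to a compact set that is not evenly continuous.
\<close>

definition two_Ascoli :: "'a topology \<Rightarrow> bool" where
  "two_Ascoli X \<longleftrightarrow>
     (\<forall>K. compactin (compact_open_topology X two) K \<longrightarrow> evenly_continuous X two K)"

lemma Tychonoff_fan_prod_fan:
  "completely_regular_space (prod_topology (fan I) (fan J)) \<and>
   Hausdorff_space (prod_topology (fan I) (fan J))"
  by (simp add: completely_regular_space_prod_topology completely_regular_space_fan
      Hausdorff_space_prod_topology Hausdorff_space_fan)

end

theory Submission
  imports Defs "HOL-Library.Countable_Set_Type"
begin

text \<open>
  Order \<open>I\<close> in type \<open>\<omega>\<^sub>1\<close> and choose, for every \<open>j\<close>, an injection \<open>e(\<cdot>, j)\<close> of the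
  predecessors of \<open>j\<close> into the natural numbers. Let \<open>H\<close> consist of the isolated points
  \<open>(Node i (e(i, j)), Node j (e(i, j)))\<close> with \<open>i < j\<close>. A compact set lies in finitely many
  products \<open>S\<^sub>i \<times> S\<^sub>j\<close>, each of which contains at most one point of \<open>H\<close>; hence the indicator
  functions of the points of \<open>H\<close> converge to \<open>0\<close> in the compact-open topology, and together
  with \<open>0\<close> they form a compact set. A neighbourhood of the apex is described by a function
  \<open>I \<rightarrow> \<nat>\<close>, which takes some value \<open>n\<close> on an uncountable set; some \<open>j\<close> in this set has infinitely
  many predecessors \<open>i\<close> in it, and \<open>e(i, j) < n\<close> for only finitely many of them. So every
  neighbourhood of the apex contains infinitely many points of \<open>H\<close>, and evaluation is
  discontinuous at the zero function and the apex.
\<close>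

section \<open>Indicators of clopen points in the compact-open topology\<close>

definition point_indicator :: "'a topology \<Rightarrow> 'a \<Rightarrow> 'a \<Rightarrow> nat" where
  "point_indicator X h = (\<lambda>x\<in>topspace X. if x = h then 1 else 0)"

definition zero_map :: "'a topology \<Rightarrow> 'a \<Rightarrow> nat" where
  "zero_map X = (\<lambda>x\<in>topspace X. 0)"

lemma zero_map_in_cont_maps: "zero_map X \<in> cont_maps X two"
proof -
  have "continuous_map X two (zero_map X)"
    by (rule continuous_map_eq[of X two "\<lambda>x. 0"]) (simp_all add: zero_map_def)
  then show ?thesis by (simp add: cont_maps_def zero_map_def)
qed

lemma point_indicator_in_cont_maps:
  assumes "openin X {h}" "closedin X {h}"
  shows "point_indicator X h \<in> cont_maps X two"
proof -
  have "openin X {x \<in> topspace X. point_indicator X h x \<in> U}" for U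
  proof -
    have "{x \<in> topspace X. point_indicator X h x \<in> U} =
        (if 1 \<in> U then {h} else {}) \<union> (if 0 \<in> U then topspace X - {h} else {})"
      using openin_subset[OF assms(1)] by (auto simp: point_indicator_def)
    moreover have "openin X (if 1 \<in> U then {h} else {})"
      using assms(1) by simp
    moreover have "openin X (if 0 \<in> U then topspace X - {h} else {})"
      using assms(2) by (simp add: closedin_def)
    ultimately show ?thesis by (simp only: openin_Un)
  qed
  then have "continuous_map X two (point_indicator X h)"
    by (auto simp: continuous_map point_indicator_def)
  then show ?thesis by (simp add: cont_maps_def point_indicator_def)
qed

text \<open>For a subbasic set given by \<open>C\<close> and \<open>U\<close>, an indicator of a
  point outside \<open>C\<close> agrees with the zero map on \<open>C\<close>, so only the finitely
  many points of \<open>C \<inter> H\<close> can fail. Finite intersections and unions preserve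
  this.\<close>

lemma point_indicators_converge_to_zero_map:
  assumes H: "\<And>h. h \<in> H \<Longrightarrow> openin X {h} \<and> closedin X {h}"
    and fin: "\<And>C. compactin X C \<Longrightarrow> finite (C \<inter> H)"
    and T: "openin (compact_open_topology X two) T" and z: "zero_map X \<in> T"
  shows "finite {h \<in> H. point_indicator X h \<notin> T}"
proof -
  let ?B = "{{f \<in> cont_maps X two. f ` K \<subseteq> U} |K U. compactin X K \<and> openin two U}"
  have "generate_topology_on ?B T"
    using T by (simp add: compact_open_topology_def openin_topology_generated_by_iff)
  then show ?thesis using z
  proof induction
    case Empty
    then show ?case by simp
  next
    case (Int a b)
    then have "finite ({h \<in> H. point_indicator X h \<notin> a} \<union> {h \<in> H. point_indicator X h \<notin> b})"
      by blast
    then show ?case by (rule rev_finite_subset) blast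
  next
    case (UN \<K>)
    then obtain k where k: "k \<in> \<K>" "zero_map X \<in> k" by blast
    with UN have "finite {h \<in> H. point_indicator X h \<notin> k}" by blast
    then show ?case by (rule rev_finite_subset) (use k in blast)
  next
    case (Basis s)
    then obtain C U where s: "s = {f \<in> cont_maps X two. f ` C \<subseteq> U}" and C: "compactin X C"
      by blast
    have "{h \<in> H. point_indicator X h \<notin> s} \<subseteq> C \<inter> H"
    proof (rule subsetI, rule ccontr)
      fix h assume h: "h \<in> {h \<in> H. point_indicator X h \<notin> s}" and "h \<notin> C \<inter> H"
      then have "h \<notin> C" by blast
      then have "point_indicator X h ` C = zero_map X ` C"
        using compactin_subset_topspace[OF C]
        by (intro image_cong) (auto simp: point_indicator_def zero_map_def)
      moreover have "zero_map X ` C \<subseteq> U" using Basis s by blast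
      moreover have "point_indicator X h \<in> cont_maps X two"
        using h H by (intro point_indicator_in_cont_maps) auto
      ultimately show False using h s by simp
    qed
    then show ?case using fin[OF C] by (rule finite_subset)
  qed
qed

text \<open>The indicators tend to the zero map, yet each takes the value 1 at its own point, and
  these points come arbitrarily close to \<open>p\<close>.\<close>

lemma not_two_Ascoli_if_isolated_points_accumulate:
  assumes H: "\<And>h. h \<in> H \<Longrightarrow> openin X {h} \<and> closedin X {h}"
    and fin: "\<And>C. compactin X C \<Longrightarrow> finite (C \<inter> H)"
    and p: "p \<in> topspace X"
    and acc: "\<And>U. openin X U \<Longrightarrow> p \<in> U \<Longrightarrow> infinite (U \<inter> H)"
  shows "\<not> two_Ascoli X"
proof
  let ?CO = "compact_open_topology X two"
  define K where "K = insert (zero_map X) (point_indicator X ` H)"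
  have K_sub: "K \<subseteq> cont_maps X two"
    unfolding K_def insert_subset image_subset_iff
    by (intro conjI ballI zero_map_in_cont_maps point_indicator_in_cont_maps) (simp_all add: H)
  have "compactin ?CO K"
    unfolding compactin_def
  proof (intro conjI allI impI)
    show "K \<subseteq> topspace ?CO" using K_sub by simp
    fix \<U> assume U: "Ball \<U> (openin ?CO) \<and> K \<subseteq> \<Union>\<U>"
    \<comment> \<open>The member of the cover around the limit already contains all but finitely
      many indicators.\<close>
    then obtain T where T: "T \<in> \<U>" "zero_map X \<in> T" by (auto simp: K_def)
    define F where "F = {h \<in> H. point_indicator X h \<notin> T}"
    have F: "finite F"
      unfolding F_def
      by (rule point_indicators_converge_to_zero_map) (use H fin U T in auto)
    have "\<forall>h\<in>F. \<exists>S\<in>\<U>. point_indicator X h \<in> S"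
      using U by (auto simp: F_def K_def)
    then obtain S where S: "\<And>h. h \<in> F \<Longrightarrow> S h \<in> \<U> \<and> point_indicator X h \<in> S h" by metis
    have "K \<subseteq> \<Union>(insert T (S ` F))"
      using T S by (fastforce simp: K_def F_def)
    moreover have "insert T (S ` F) \<subseteq> \<U>" using T S by auto
    ultimately show "\<exists>\<F>. finite \<F> \<and> \<F> \<subseteq> \<U> \<and> K \<subseteq> \<Union>\<F>"
      using F by (meson finite_imageI finite_insert)
  qed
  moreover assume "two_Ascoli X"
  ultimately have "evenly_continuous X two K" by (simp add: two_Ascoli_def)
  define Z where "Z = {z \<in> topspace (prod_topology (subtopology ?CO K) X). (\<lambda>(f, x). f x) z \<in> {0}}"
  have "openin (prod_topology (subtopology ?CO K) X) Z"
    unfolding Z_def using \<open>evenly_continuous X two K\<close>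
    by (intro openin_continuous_map_preimage[of _ two]) (simp_all add: evenly_continuous_def)
  moreover have "zero_map X p = 0" using p by (simp add: zero_map_def)
  then have "(zero_map X, p) \<in> Z"
    using p zero_map_in_cont_maps[of X] by (simp add: Z_def K_def)
  ultimately obtain V U where V: "openin (subtopology ?CO K) V" and U: "openin X U"
    and zV: "zero_map X \<in> V" and pU: "p \<in> U" and VU: "V \<times> U \<subseteq> Z"
    unfolding openin_prod_topology_alt by metis
  obtain T where T: "openin ?CO T" "V = T \<inter> K"
    using V by (auto simp: openin_subtopology)
  have "finite {h \<in> H. point_indicator X h \<notin> T}"
    using T zV by (intro point_indicators_converge_to_zero_map[OF H fin]) auto
  \<comment> \<open>Infinitely many candidates in \<open>U\<close> against finitely many exceptions
    to \<open>T\<close>: some \<open>h\<close> has its indicator in the box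
    \<open>V \<times> U\<close> as well, where evaluation should be 0.\<close>
  with acc[OF U pU] have "\<not> U \<inter> H \<subseteq> {h \<in> H. point_indicator X h \<notin> T}"
    using finite_subset by blast
  then obtain h where h: "h \<in> U" "h \<in> H" "point_indicator X h \<in> T" by blast
  then have "(point_indicator X h, h) \<in> V \<times> U" by (simp add: T K_def)
  then have "(point_indicator X h, h) \<in> Z" using VU by (rule subsetD[rotated])
  then have "point_indicator X h h = 0" by (simp add: Z_def)
  moreover have "h \<in> topspace X" using openin_subset[OF U] h by blast
  ultimately show False by (simp add: point_indicator_def)
qed

section \<open>Compact sets and neighbourhoods in the fan and its square\<close>

lemma compactin_fan_finite_spines:
  assumes "compactin (fan I) C"
  shows "finite {i. \<exists>n. Node i n \<in> C}"
proof -
  define D where "D = {i. \<exists>n. Node i n \<in> C}"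
  define g where "g i = (SOME n. Node i n \<in> C)" for i
  have g: "Node i (g i) \<in> C" if "i \<in> D" for i
    using that unfolding D_def g_def by (auto intro: someI)
  have C: "C \<subseteq> fan_set I" using compactin_subset_topspace[OF assms] by simp
  define P where "P = (\<lambda>i. Node i (g i)) ` D"
  define W where "W i = insert (Node i (g i)) (fan_set I - P)" for i
  have "openin (fan I) (W i)" if "i \<in> D" for i
  proof -
    have "W i \<subseteq> fan_set I" using g[OF that] C by (auto simp: W_def)
    moreover have "finite {n. Node j n \<notin> W i}" if "j \<in> I" for j
      by (rule finite_subset[of _ "{g j}"]) (use that in \<open>auto simp: W_def P_def fan_set_def\<close>)
    ultimately show ?thesis by (simp add: openin_fan)
  qed
  moreover have "openin (fan I) (fan_set I - P)"
  proof -
    have "finite {n. Node j n \<notin> fan_set I - P}" if "j \<in> I" for j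
      by (rule finite_subset[of _ "{g j}"]) (use that in \<open>auto simp: P_def fan_set_def\<close>)
    then show ?thesis by (auto simp: openin_fan)
  qed
  moreover have "C \<subseteq> \<Union>(insert (fan_set I - P) (W ` D))"
    using C by (auto simp: W_def P_def)
  ultimately have "\<exists>\<F>. finite \<F> \<and> \<F> \<subseteq> insert (fan_set I - P) (W ` D) \<and> C \<subseteq> \<Union>\<F>"
    by (intro compactinD[OF assms]) auto
  then obtain \<F> where \<F>: "finite \<F>" "\<F> \<subseteq> insert (fan_set I - P) (W ` D)" "C \<subseteq> \<Union>\<F>"
    by blast
  have "finite (\<F> - {fan_set I - P})" "\<F> - {fan_set I - P} \<subseteq> W ` D" using \<F> by auto
  then obtain E where E: "finite E" "\<F> - {fan_set I - P} = W ` E"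
    by (meson finite_subset_image)
  have "D \<subseteq> E"
  proof
    fix i assume i: "i \<in> D"
    then obtain S where S: "S \<in> \<F>" "Node i (g i) \<in> S" using \<F>(3) g[OF i] by blast
    moreover have "Node i (g i) \<in> P" using i by (simp add: P_def)
    ultimately have "S \<in> W ` E" using E(2) by blast
    then show "i \<in> E" using S \<open>Node i (g i) \<in> P\<close> by (auto simp: W_def)
  qed
  then show ?thesis using E(1) finite_subset unfolding D_def by blast
qed

text \<open>\<open>L j\<close> stands for the predecessors of \<open>j\<close>, and
  \<open>e i j\<close> for the code of \<open>i\<close> among them. A pair of spines
  \<open>(i, j)\<close> carries at most one point.\<close>

definition ladder_points :: "('i \<Rightarrow> 'i set) \<Rightarrow> ('i \<Rightarrow> 'i \<Rightarrow> nat) \<Rightarrow> 'i set \<Rightarrow>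
    ('i fan_point \<times> 'i fan_point) set" where
  "ladder_points L e I = {(Node i (e i j), Node j (e i j)) |i j. j \<in> I \<and> i \<in> L j}"

text \<open>Both projections of \<open>C\<close> are compact, so only finitely many pairs of spines
  are involved.\<close>

lemma compactin_ladder_points_finite:
  assumes "compactin (prod_topology (fan I) (fan I)) C"
  shows "finite (C \<inter> ladder_points L e I)"
proof -
  let ?A = "{i. \<exists>n. Node i n \<in> fst ` C}" and ?B = "{i. \<exists>n. Node i n \<in> snd ` C}"
  have "finite ?A" "finite ?B"
    using assms image_compactin continuous_map_fst continuous_map_snd
    by (intro compactin_fan_finite_spines[of I]; blast)+
  then have "finite ((\<lambda>(i, j). (Node i (e i j), Node j (e i j))) ` (?A \<times> ?B))" by blast
  then show ?thesis
    by (rule rev_finite_subset) (force simp: ladder_points_def image_iff)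
qed

text \<open>A countably infinite part \<open>Y\<close> of \<open>Z\<close> and all predecessors of
  its elements do not exhaust \<open>Z\<close>; by comparability, any \<open>j\<close> left over has
  all of \<open>Y\<close> below it.\<close>

lemma uncountable_has_infinite_predecessors:
  assumes Z: "uncountable Z" "Z \<subseteq> I"
    and total: "\<And>i j. i \<in> I \<Longrightarrow> j \<in> I \<Longrightarrow> i = j \<or> i \<in> L j \<or> j \<in> L i"
    and L: "\<And>j. j \<in> I \<Longrightarrow> countable (L j)"
  shows "\<exists>j\<in>Z. infinite (L j \<inter> Z)"
proof -
  have "infinite Z" using Z countable_finite by blast
  then obtain Y where Y: "Y \<subseteq> Z" "countable Y" "infinite Y"
    using infinite_countable_subset' by blast
  have "countable (Y \<union> (\<Union>i\<in>Y. L i))" using Y Z L by auto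
  then have "\<not> Z \<subseteq> Y \<union> (\<Union>i\<in>Y. L i)"
    using Z(1) countable_subset by blast
  then obtain j where j: "j \<in> Z" "j \<notin> Y" "\<And>i. i \<in> Y \<Longrightarrow> j \<notin> L i"
    by blast
  have "i \<in> L j" if "i \<in> Y" for i
    using total[of i j] that j Y(1) Z(2) by auto
  then have "Y \<subseteq> L j \<inter> Z" using Y(1) by auto
  then show ?thesis using j(1) Y(3) finite_subset by blast
qed

lemma ladder_points_accumulate:
  assumes I: "uncountable I"
    and total: "\<And>i j. i \<in> I \<Longrightarrow> j \<in> I \<Longrightarrow> i = j \<or> i \<in> L j \<or> j \<in> L i"
    and L: "\<And>j. j \<in> I \<Longrightarrow> countable (L j)"
    and e: "\<And>j. j \<in> I \<Longrightarrow> inj_on (\<lambda>i. e i j) (L j)"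
    and U: "openin (prod_topology (fan I) (fan I)) U" "(Apex, Apex) \<in> U"
  shows "infinite (U \<inter> ladder_points L e I)"
proof -
  obtain V W where V: "openin (fan I) V" "Apex \<in> V" and W: "openin (fan I) W" "Apex \<in> W"
    and VW: "V \<times> W \<subseteq> U"
    using U unfolding openin_prod_topology_alt by blast
  \<comment> \<open>Intersecting the two factors lets a single function \<open>f\<close> bound both
    coordinates.\<close>
  have "openin (fan I) (V \<inter> W)" using V W by blast
  then have "\<forall>i\<in>I. finite {n. Node i n \<notin> V \<inter> W}" using V W by (simp add: openin_fan)
  then have "\<forall>i\<in>I. \<exists>k. \<forall>n\<ge>k. Node i n \<in> V \<inter> W"
    by (metis (mono_tags, lifting) finite_nat_set_iff_bounded mem_Collect_eq not_le)
  then obtain f where f: "\<And>i n. i \<in> I \<Longrightarrow> f i \<le> n \<Longrightarrow> Node i n \<in> V \<inter> W" by metis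
  have "I = (\<Union>k. {i\<in>I. f i = k})" by blast
  then obtain k where "uncountable {i\<in>I. f i = k}"
    using I countable_UN[OF countableI_type, of UNIV "\<lambda>k. {i\<in>I. f i = k}"] by auto
  then obtain j where j: "j \<in> I" "f j = k" and inf: "infinite (L j \<inter> {i\<in>I. f i = k})"
    using uncountable_has_infinite_predecessors[of "{i\<in>I. f i = k}" I L] total L by blast
  \<comment> \<open>Since \<open>e\<close> is injective in \<open>i\<close>, only finitely many
    predecessors have a code below the common threshold \<open>k\<close>.\<close>
  define G where "G = {i \<in> L j \<inter> {i\<in>I. f i = k}. k \<le> e i j}"
  have "finite {i \<in> L j. e i j \<in> {..<k}}"
    using finite_vimage_IntI[OF finite_lessThan e[OF j(1)]]
    by (rule rev_finite_subset) auto
  moreover have "L j \<inter> {i\<in>I. f i = k} \<subseteq> G \<union> {i \<in> L j. e i j \<in> {..<k}}"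
    by (auto simp: G_def)
  ultimately have "infinite G" using inf finite_subset by blast
  moreover have "inj_on (\<lambda>i. (Node i (e i j), Node j (e i j))) G" by (auto simp: inj_on_def)
  ultimately have "infinite ((\<lambda>i. (Node i (e i j), Node j (e i j))) ` G)"
    by (simp add: finite_image_iff)
  moreover have "(\<lambda>i. (Node i (e i j), Node j (e i j))) ` G \<subseteq> U \<inter> ladder_points L e I"
    using VW f j by (fastforce simp: G_def ladder_points_def)
  ultimately show ?thesis using finite_subset by blast
qed

section \<open>The index set as a copy of \<omega>_1\<close>

lemma uncountable_if_card_cardSuc_natLeq:
  assumes "|I| =o cardSuc natLeq"
  shows "uncountable I"
proof
  assume "countable I"
  then have "|I| \<le>o natLeq" by (simp add: countable_card_le_natLeq)
  moreover have "natLeq <o |I|"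
    using cardSuc_greater[OF natLeq_Card_order] assms ordIso_symmetric ordLess_ordIso_trans by blast
  ultimately show False using not_ordLess_ordLeq by blast
qed

text \<open>A proper initial segment of a cardinal order has smaller cardinality, and below the
  successor of \<aleph>_0 this means at most \<aleph>_0.\<close>

lemma countable_underS_if_card_cardSuc_natLeq:
  assumes "|I| =o cardSuc natLeq" "j \<in> I"
  shows "countable (underS ( |I| ) j)"
proof -
  have "|underS ( |I| ) j| <o |I|"
    using assms(2) by (intro card_of_underS card_of_Card_order) (simp add: Field_card_of)
  then have "|underS ( |I| ) j| <o cardSuc natLeq" using assms(1) ordLess_ordIso_trans by blast
  then show ?thesis
    by (simp add: countable_card_le_natLeq cardSuc_ordLeq_ordLess
        natLeq_Card_order card_of_Card_order)
qed

theorem proposition2p14: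
  fixes I :: "'i set"
  assumes "|I| =o cardSuc natLeq"
  shows "\<not> two_Ascoli (prod_topology (fan I) (fan I))"
proof -
  \<comment> \<open>The cardinal \<open>|I|\<close> is itself a well-order on \<open>I\<close>, so
    it supplies the predecessors; countability of \<open>L j\<close> makes \<open>to_nat_on\<close>
    injective there.\<close>
  define L where "L = underS |I|"
  define e where "e i j = to_nat_on (L j) i" for i j
  have L: "countable (L j)" if "j \<in> I" for j
    using countable_underS_if_card_cardSuc_natLeq assms that by (simp add: L_def)
  have LI: "L j \<subseteq> I" for j
    by (auto simp: L_def underS_def Field_card_of dest: FieldI1)
  have total: "i = j \<or> i \<in> L j \<or> j \<in> L i" if "i \<in> I" "j \<in> I" for i j
    using card_of_Well_order[of I] that
    by (auto simp: L_def underS_def Field_card_of well_order_on_def linear_order_on_def total_on_def)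
  show ?thesis
  proof (rule not_two_Ascoli_if_isolated_points_accumulate)
    show "infinite (U \<inter> ladder_points L e I)"
      if "openin (prod_topology (fan I) (fan I)) U" "(Apex, Apex) \<in> U" for U
      using uncountable_if_card_cardSuc_natLeq[OF assms] total L _ that
      by (rule ladder_points_accumulate) (simp_all add: e_def L inj_on_to_nat_on)
  next
    fix h assume "h \<in> ladder_points L e I"
    then obtain i j n where h: "h = (Node i n, Node j n)" and ij: "i \<in> I" "j \<in> I"
      using LI unfolding ladder_points_def by blast
    have "openin (prod_topology (fan I) (fan I)) ({Node i n} \<times> {Node j n})"
      using ij by (intro openin_prod_Times_iff[THEN iffD2] disjI2 conjI openin_fan_no_Apex)
        (simp_all add: fan_set_def)
    moreover have "h \<in> topspace (prod_topology (fan I) (fan I))"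
      using ij by (simp add: h fan_set_def)
    ultimately show "openin (prod_topology (fan I) (fan I)) {h} \<and>
        closedin (prod_topology (fan I) (fan I)) {h}"
      using Tychonoff_fan_prod_fan[of I I]
      by (simp add: h closedin_Hausdorff_singleton)
  qed (auto simp: compactin_ladder_points_finite fan_set_def)
qed

end
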